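(* Let $A\in\mathbb{R}^{n\times n}$ be Hurwitz, $B\in\mathbb{R}^{n\times m}$, $C\in\mathbb{R}^{p\times n}$, $\bar T>0$, and let $\hat A\in\mathbb{R}^{r\times r}$, $\hat B\in\mathbb{R}^{r\times m}$, $\hat C\in\mathbb{R}^{p\times r}$ be such that the reduced system $(\hat A,\hat B,\hat C)$ is a locally optimal approximation of $(A,B,C)$ with respect to the time-limited $\mathcal H_2$-norm, i.e. $(\hat A,\hat B,\hat C)$ is a local minimizer, among all reduced matrices of these sizes, of $\int_0^{\bar T}\|Ce^{As}B-\hat Ce^{\hat As}\hat B\|_F^2\,ds$. Assume $\hat A$ is diagonalizable, $\hat A=S^{-1}DS$ with $D=\operatorname{diag}(\lambda_1,\dots,\lambda_r)$, that $D$ and $-D$ have no common eigenvalues and that $D$ and $-A$ have no common eigenvalues. Set $\tilde B=S\hat B$, $\tilde C=\hat CS^{-1}$, and let $\tilde P_{\bar T},\tilde P_{2,\bar T},\tilde Q_{\bar T},\tilde Q_{2,\bar T},\tilde Q_\infty,\tilde Q_{2,\infty}$ be the solutions of $$A \tilde P_{2, {\bar T}}+ \tilde P_{2, {\bar T}} D =-B \tilde B^T+e^{A \bar T}B \tilde B^T e^{D \bar T},\qquad D\tilde P_{\bar T}+\tilde P_{\bar T} D =-\tilde B \tilde B^T+e^{D \bar T}\tilde B \tilde B^T e^{D \bar T},$$ $$D \tilde Q_{2, {\bar T}}+ \tilde Q_{2, {\bar T}} A =-\tilde C^T C+e^{D \bar T} \tilde C^T C e^{A \bar T},\qquad D \tilde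 Q_{\bar T}+\tilde Q_{\bar T} D =-\tilde C^T \tilde C+e^{D \bar T}\tilde C^T \tilde C e^{D \bar T},$$ $$D \tilde Q_{\infty}+\tilde Q_{\infty} D =-\tilde C^T \tilde C,\qquad D \tilde Q_{2, {\infty}}+ \tilde Q_{2, {\infty}} A =-\tilde C^T C.$$ Then (1) $\tilde C \tilde P_{\bar T} = C \tilde P_{2, \bar T}$; (2) $\tilde Q_{\bar T}\tilde B = \tilde Q_{2, \bar T} B$; (3) for all $i\in\{1,\dots,r\}$: $e_i^T\tilde Q_{2, \infty}[\tilde P_{2, {\bar T}}-\bar T e^{A\bar T}B \tilde B^T e^{D \bar T}]e_i= e_i^T\tilde Q_{\infty}[\tilde P_{\bar T}-\bar Te^{D \bar T}\tilde B \tilde B^T e^{D \bar T}]e_i$. Equivalently (with all displayed inverses assumed to exist), $$(I\otimes \hat C) \left[(I\otimes \hat A)+(D\otimes I)\right]^{-1}(e^{D \bar T}\tilde B \otimes e^{\hat A \bar T}\hat B -\tilde B \otimes \hat B) \operatorname{vec}(I) = (I\otimes C) \left[(I\otimes A)+(D\otimes I)\right]^{-1} (e^{D \bar T}\tilde B \otimes e^{ A \bar T} B -\tilde B \otimes B) \operatorname{vec}(I),$$ $$(\hat B^T\otimes I) \left[(I\otimes D)+(\hat A^T\otimes I)\right]^{-1}(e^{\hat A^T \bar T}\hat C^T \otimes e^{D \bar T}\tilde C^T-\hat C^T \otimes \tilde C^T)\operatorname{vec}(I) = (B^T\otimes I) \left[(I\otimes D)+(A^T\otimes I)\right]^{-1}(e^{A^T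 \bar T} C^T \otimes e^{D \bar T}\tilde C^T-C^T \otimes \tilde C^T)\operatorname{vec}(I),$$ and for all $i=1,\ldots,r$ $$\operatorname{vec}^T(I) (\hat C \otimes \tilde C) \left[(I\otimes D)+(\hat A\otimes I)\right]^{-1} (I\otimes e_i e_i^T)\Big( \left[(I\otimes D)+(\hat A\otimes I)\right]^{-1} (e^{\hat A \bar T}\hat B \otimes e^{D \bar T}\tilde B -\hat B \otimes \tilde B)- (\bar Te^{\hat A \bar T}\hat B \otimes e^{D \bar T}\tilde B) \Big)\operatorname{vec}(I)$$ $$=\operatorname{vec}^T(I) ( C \otimes \tilde C) \left[(I\otimes D)+(A\otimes I)\right]^{-1} (I\otimes e_i e_i^T)\Big( \left[(I\otimes D)+(A\otimes I)\right]^{-1} (e^{A \bar T} B \otimes e^{D \bar T}\tilde B -B \otimes \tilde B)-(\bar Te^{A \bar T}B \otimes e^{D \bar T}\tilde B)\Big) \operatorname{vec}(I).$$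
   Context: $e_i$ is the $i$-th column of an identity matrix, $I$ denotes identity matrices of suitable sizes, $\otimes$ is the Kronecker product, $\operatorname{vec}$ stacks the columns of a matrix into a vector, $\operatorname{vec}^T(I)=(\operatorname{vec}(I))^T$, $\|\cdot\|_F$ is the Frobenius norm. Transposes are plain (not conjugate) transposes even when $S$, $D$ are complex. *)

theory Defs
  imports "HOL-Analysis.Analysis"
begin

text \<open>Matrices are elements of 'a^'c^'r (rows indexed by 'r, columns by 'c).
  Matrix product is (**), transpose is the plain transpose.\<close>

primrec matpow :: "('a::semiring_1)^'n^'n \<Rightarrow> nat \<Rightarrow> 'a^'n^'n" where
  "matpow M 0 = mat 1"
| "matpow M (Suc k) = M ** matpow M k"

text \<open>Matrix exponential e^{M t} as the exponential power series.\<close>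
definition mexp :: "('a::real_normed_algebra_1)^'n^'n \<Rightarrow> real \<Rightarrow> 'a^'n^'n" where
  "mexp M t = (\<Sum>k. (t ^ k / fact k) *\<^sub>R matpow M k)"

text \<open>Entrywise embedding of a real matrix into complex matrices.\<close>
definition cmat :: "real^'c^'r \<Rightarrow> complex^'c^'r" where
  "cmat M = (\<chi> i j. complex_of_real (M $ i $ j))"

text \<open>Eigenvalue of a complex square matrix.\<close>
definition ceigenvalue :: "complex^'n^'n \<Rightarrow> complex \<Rightarrow> bool" where
  "ceigenvalue M l \<longleftrightarrow> (\<exists>v. v \<noteq> 0 \<and> M *v v = l *s v)"

text \<open>Hurwitz: every (complex) eigenvalue has negative real part.\<close>
definition hurwitz :: "real^'n^'n \<Rightarrow> bool" where
  "hurwitz A \<longleftrightarrow> (\<forall>l. ceigenvalue (cmat A) l \<longrightarrow> Re l < 0)"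

text \<open>Time-limited H2 error functional
  \<integral>_0^T ||C e^{As} B - Ch e^{Ah s} Bh||_F^2 ds.  The norm on real^'m^'p is the
  Euclidean norm of all entries, i.e. the Frobenius norm.\<close>
definition tlh2_err ::
  "real^'n^'n \<Rightarrow> real^'m^'n \<Rightarrow> real^'n^'p \<Rightarrow> real \<Rightarrow>
   real^'r^'r \<Rightarrow> real^'m^'r \<Rightarrow> real^'r^'p \<Rightarrow> real" where
  "tlh2_err A B C T Ah Bh Ch =
     integral {0..T} (\<lambda>s. (norm (C ** mexp A s ** B - Ch ** mexp Ah s ** Bh))\<^sup>2)"

text \<open>Local minimizer over all real reduced triples of the same sizes.\<close>
definition tlh2_locally_optimal ::
  "real^'n^'n \<Rightarrow> real^'m^'n \<Rightarrow> real^'n^'p \<Rightarrow> real \<Rightarrow>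
   real^'r^'r \<Rightarrow> real^'m^'r \<Rightarrow> real^'r^'p \<Rightarrow> bool" where
  "tlh2_locally_optimal A B C T Ah Bh Ch \<longleftrightarrow>
     (\<exists>\<epsilon>>0. \<forall>(Ah'::real^'r^'r) (Bh'::real^'m^'r) (Ch'::real^'r^'p).
        norm (Ah' - Ah) + norm (Bh' - Bh) + norm (Ch' - Ch) < \<epsilon> \<longrightarrow>
        tlh2_err A B C T Ah Bh Ch \<le> tlh2_err A B C T Ah' Bh' Ch')"

end

(*
  Local optimality is tested along three families of perturbations of the reduced model:
  Ch + t E, Bh + t E, and Ah + t E with E commuting with Ah.  Differentiating the error
  integral at t = 0 gives orthogonality relations between the residual
  C e^{As} B - Ch e^{Ah s} Bh and the corresponding directions.  In the eigenbasis of Ah the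
  integrals occurring there are time-limited Gramians \<int>_0^T e^{K1 s} X e^{K2 s} ds (or their
  s-weighted versions), and the fundamental theorem of calculus shows that they solve the
  Sylvester equations of the statement; the spectral hypotheses make these solutions unique.
  The commuting perturbations only yield the diagonal of the corresponding matrix identity.
*)

theory Submission
  imports Defs
begin

section \<open>Matrix identities\<close>

lemma matrix_add_rdistrib: "(A + B) ** C = A ** C + B ** (C::'a::semiring_1^_^_)"
  by (vector matrix_matrix_mult_def sum.distrib field_simps)

lemma matrix_diff_rdistrib: "(A - B) ** C = A ** C - B ** (C::'a::ring_1^_^_)"
  by (vector matrix_matrix_mult_def sum_subtractf algebra_simps)

lemma matrix_diff_ldistrib: "C ** (A - B) = C ** A - C ** (B::'a::ring_1^_^_)"
  by (vector matrix_matrix_mult_def sum_subtractf algebra_simps)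

lemma matrix_neg_rdistrib: "(- A) ** C = - (A ** (C::'a::ring_1^_^_))"
  by (vector matrix_matrix_mult_def sum_negf)

lemma matrix_neg_ldistrib: "C ** (- A) = - (C ** (A::'a::ring_1^_^_))"
  by (vector matrix_matrix_mult_def sum_negf)

lemma transpose_add: "transpose (A + B) = transpose A + transpose B"
  by (simp add: transpose_def vec_eq_iff)

lemma scaleR_matrix_matrix_mult_right: "r *\<^sub>R (A ** B) = A ** (r *\<^sub>R (B::'a::real_algebra_1^_^_))"
  by (metis matrix_scalar_ac scalar_matrix_assoc)

section \<open>Square matrices as a Banach algebra\<close>

lemma norm_axis_one: "norm (axis j (1::'a::real_normed_algebra_1) :: 'a^'n::finite) = 1"
proof -
  have "(\<Sum>i\<in>UNIV. (norm ((axis j (1::'a) :: 'a^'n) $ i))\<^sup>2) = (\<Sum>i\<in>UNIV. if i = j then 1 else 0)"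
    by (rule sum.cong) (auto simp: axis_def)
  then show ?thesis
    by (simp add: norm_vec_def L2_set_def)
qed

lemma norm_vec_le_sum: "norm (x::'a::real_normed_vector^'n::finite) \<le> (\<Sum>i\<in>UNIV. norm (x $ i))"
  by (simp add: norm_vec_def L2_set_le_sum)

lemma bounded_linear_matrix_vector_mult:
  "bounded_linear ((*v) (M::'a::{euclidean_space,real_normed_field}^'n::finite^'m::finite))"
  by simp

lemma matrix_entry_le_onorm:
  "norm ((M::'a::{euclidean_space,real_normed_field}^'n::finite^'m::finite) $ i $ j) \<le> onorm ((*v) M)"
proof -
  have "(M *v axis j 1) $ i = M $ i $ j"
    by (simp add: matrix_vector_mult_def axis_def if_distrib cong: if_cong)
  then have "norm (M $ i $ j) \<le> norm (M *v axis j 1)"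
    by (metis Finite_Cartesian_Product.norm_nth_le)
  also have "\<dots> \<le> onorm ((*v) M) * norm (axis j (1::'a))"
    by (rule onorm[OF bounded_linear_matrix_vector_mult])
  finally show ?thesis
    by (simp add: norm_axis_one)
qed

lemma onorm_le_matrix_entries:
  "onorm ((*v) (M::'a::{euclidean_space,real_normed_field}^'n::finite^'m::finite))
     \<le> (\<Sum>i\<in>UNIV. \<Sum>j\<in>UNIV. norm (M $ i $ j))"
proof (rule onorm_le)
  fix x :: "'a^'n"
  have "norm ((M *v x) $ i) \<le> (\<Sum>j\<in>UNIV. norm (M $ i $ j) * norm x)" for i
  proof -
    have "norm ((M *v x) $ i) \<le> (\<Sum>j\<in>UNIV. norm (M $ i $ j * x $ j))"
      unfolding matrix_vector_mult_def by (simp add: norm_sum)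
    also have "\<dots> \<le> (\<Sum>j\<in>UNIV. norm (M $ i $ j) * norm x)"
      by (intro sum_mono) (simp add: norm_mult mult_left_mono Finite_Cartesian_Product.norm_nth_le)
    finally show ?thesis .
  qed
  then have "norm (M *v x) \<le> (\<Sum>i\<in>UNIV. \<Sum>j\<in>UNIV. norm (M $ i $ j) * norm x)"
    by (rule order_trans[OF norm_vec_le_sum sum_mono])
  then show "norm (M *v x) \<le> (\<Sum>i\<in>UNIV. \<Sum>j\<in>UNIV. norm (M $ i $ j)) * norm x"
    by (simp add: sum_distrib_right)
qed

typedef (overloaded) ('a, 'n) sq_matrix =
  "UNIV :: ('a::{euclidean_space,real_normed_field}^'n::finite^'n) set"
  morphisms mrep mabs
  by auto

setup_lifting type_definition_sq_matrix

instantiation sq_matrix :: ("{euclidean_space,real_normed_field}", finite) real_normed_algebra_1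
begin

lift_definition zero_sq_matrix :: "('a,'b) sq_matrix" is "0 :: 'a^'b^'b" .
lift_definition one_sq_matrix :: "('a,'b) sq_matrix" is "mat 1 :: 'a^'b^'b" .
lift_definition plus_sq_matrix :: "('a,'b) sq_matrix \<Rightarrow> ('a,'b) sq_matrix \<Rightarrow> ('a,'b) sq_matrix" is "(+) :: 'a^'b^'b \<Rightarrow> _" .
lift_definition minus_sq_matrix :: "('a,'b) sq_matrix \<Rightarrow> ('a,'b) sq_matrix \<Rightarrow> ('a,'b) sq_matrix" is "(-) :: 'a^'b^'b \<Rightarrow> _" .
lift_definition uminus_sq_matrix :: "('a,'b) sq_matrix \<Rightarrow> ('a,'b) sq_matrix" is "uminus :: 'a^'b^'b \<Rightarrow> _" .
lift_definition times_sq_matrix :: "('a,'b) sq_matrix \<Rightarrow> ('a,'b) sq_matrix \<Rightarrow> ('a,'b) sq_matrix" is "(**) :: 'a^'b^'b \<Rightarrow> _" .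
lift_definition scaleR_sq_matrix :: "real \<Rightarrow> ('a,'b) sq_matrix \<Rightarrow> ('a,'b) sq_matrix" is "scaleR :: real \<Rightarrow> 'a^'b^'b \<Rightarrow> _" .
lift_definition norm_sq_matrix :: "('a,'b) sq_matrix \<Rightarrow> real" is "\<lambda>M::'a^'b^'b. onorm ((*v) M)" .

definition dist_sq_matrix :: "('a,'b) sq_matrix \<Rightarrow> ('a,'b) sq_matrix \<Rightarrow> real"
  where "dist_sq_matrix a b = norm (a - b)"

definition sgn_sq_matrix :: "('a,'b) sq_matrix \<Rightarrow> ('a,'b) sq_matrix"
  where "sgn_sq_matrix x = inverse (norm x) *\<^sub>R x"

definition uniformity_sq_matrix :: "(('a,'b) sq_matrix \<times> ('a,'b) sq_matrix) filter"
  where "uniformity_sq_matrix = (INF e\<in>{0 <..}. principal {(x, y). dist x y < e})"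

definition open_sq_matrix :: "('a,'b) sq_matrix set \<Rightarrow> bool"
  where "open_sq_matrix U = (\<forall>x\<in>U. \<forall>\<^sub>F (x', y) in uniformity. x' = x \<longrightarrow> y \<in> U)"

instance
proof
  fix a b c :: "('a,'b) sq_matrix" and r s :: real
  show "a + b + c = a + (b + c)" by transfer (simp add: algebra_simps)
  show "a + b = b + a" by transfer (simp add: algebra_simps)
  show "0 + a = a" by transfer simp
  show "- a + a = 0" by transfer simp
  show "a - b = a + - b" by transfer simp
  show "r *\<^sub>R (a + b) = r *\<^sub>R a + r *\<^sub>R b" by transfer (simp add: algebra_simps)
  show "(r + s) *\<^sub>R a = r *\<^sub>R a + s *\<^sub>R a" by transfer (simp add: algebra_simps)
  show "r *\<^sub>R s *\<^sub>R a = (r * s) *\<^sub>R a" by transfer simp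
  show "1 *\<^sub>R a = a" by transfer simp
  show "a * b * c = a * (b * c)" by transfer (simp add: matrix_mul_assoc)
  show "1 * a = a" by transfer simp
  show "a * 1 = a" by transfer simp
  show "(a + b) * c = a * c + b * c" by transfer (simp add: matrix_add_rdistrib)
  show "a * (b + c) = a * b + a * c" by transfer (simp add: matrix_add_ldistrib)
  show "(0::('a,'b) sq_matrix) \<noteq> 1"
    by transfer (simp add: mat_def vec_eq_iff)
  show "r *\<^sub>R a * b = r *\<^sub>R (a * b)" by transfer (rule scalar_matrix_assoc[symmetric])
  show "a * r *\<^sub>R b = r *\<^sub>R (a * b)" by transfer (rule scaleR_matrix_matrix_mult_right[symmetric])
  show "dist a b = norm (a - b)" "sgn a = inverse (norm a) *\<^sub>R a"
    by (simp_all add: dist_sq_matrix_def sgn_sq_matrix_def)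
  show "uniformity = (INF e\<in>{0<..}. principal {(x, y). dist (x::('a,'b) sq_matrix) y < e})"
    by (simp add: uniformity_sq_matrix_def)
  show "open U = (\<forall>x\<in>U. \<forall>\<^sub>F (x', y) in uniformity. x' = x \<longrightarrow> y \<in> U)" for U :: "('a,'b) sq_matrix set"
    by (simp add: open_sq_matrix_def)
  show "norm a = 0 \<longleftrightarrow> a = 0"
    by transfer (auto simp: onorm_eq_0 matrix_eq)
  show "norm (a + b) \<le> norm a + norm b"
    by transfer (simp add: onorm_triangle[OF bounded_linear_matrix_vector_mult bounded_linear_matrix_vector_mult,
          unfolded matrix_vector_mult_add_rdistrib[symmetric]])
  show "norm (r *\<^sub>R a) = \<bar>r\<bar> * norm a"
  proof transfer
    fix r and A :: "'a^'b^'b"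
    have "(r *\<^sub>R A) *v x = r *\<^sub>R (A *v x)" for x
      by (simp add: matrix_vector_mult_def vec_eq_iff scaleR_sum_right)
    then have "(*v) (r *\<^sub>R A) = (\<lambda>x. r *\<^sub>R (A *v x))"
      by (rule ext)
    then show "onorm ((*v) (r *\<^sub>R A)) = \<bar>r\<bar> * onorm ((*v) A)"
      by (simp add: onorm_scaleR[OF bounded_linear_matrix_vector_mult])
  qed
  show "norm (a * b) \<le> norm a * norm b"
  proof transfer
    fix A B :: "'a^'b^'b"
    have "(*v) (A ** B) = (*v) A \<circ> (*v) B"
      by (rule ext) (simp add: matrix_vector_mul_assoc)
    then show "onorm ((*v) (A ** B)) \<le> onorm ((*v) A) * onorm ((*v) B)"
      by (simp add: onorm_compose[OF bounded_linear_matrix_vector_mult bounded_linear_matrix_vector_mult])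
  qed
  show "norm (1::('a,'b) sq_matrix) = 1"
  proof transfer
    have "(*v) (mat 1 :: 'a^'b^'b) = (\<lambda>x. x)"
      by (rule ext) simp
    then show "onorm ((*v) (mat 1 :: 'a^'b^'b)) = 1"
      by (simp add: onorm_id)
  qed
qed

end

lemma mrep_add: "mrep (a + b) = mrep a + mrep b"
  and mrep_scaleR: "mrep (r *\<^sub>R a) = r *\<^sub>R mrep a"
  and mrep_mult: "mrep (a * b) = mrep a ** mrep b"
  and mrep_one: "mrep 1 = mat 1"
  by (transfer, rule refl)+

lemma mrep_power: "mrep (a ^ k) = matpow (mrep a) k"
  by (induct k) (simp_all add: mrep_one mrep_mult)

lemma norm_mrep_entry_le: "norm (mrep X $ i $ j) \<le> norm X"
  by (simp add: norm_sq_matrix.rep_eq matrix_entry_le_onorm)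

lemma bounded_linear_mrep:
  "bounded_linear (mrep :: ('a::{euclidean_space,real_normed_field},'n::finite) sq_matrix \<Rightarrow> _)"
proof
  show "mrep (a + b) = mrep a + mrep b" "mrep (r *\<^sub>R a) = r *\<^sub>R mrep a" for r and a b :: "('a,'n) sq_matrix"
    by (simp_all add: mrep_add mrep_scaleR)
  show "\<exists>K. \<forall>x::('a,'n) sq_matrix. norm (mrep x) \<le> norm x * K"
  proof (intro exI allI)
    fix x :: "('a,'n) sq_matrix"
    have "norm (mrep x $ i) \<le> (\<Sum>j\<in>(UNIV::'n set). norm x)" for i
    proof -
      have "(\<Sum>j\<in>UNIV. norm (mrep x $ i $ j)) \<le> (\<Sum>j\<in>(UNIV::'n set). norm x)"
        by (intro sum_mono norm_mrep_entry_le)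
      then show ?thesis
        using norm_vec_le_sum[of "mrep x $ i"] by linarith
    qed
    then have "(\<Sum>i\<in>UNIV. norm (mrep x $ i)) \<le> (\<Sum>i\<in>(UNIV::'n set). \<Sum>j\<in>(UNIV::'n set). norm x)"
      by (intro sum_mono)
    then have "norm (mrep x) \<le> (\<Sum>i\<in>(UNIV::'n set). \<Sum>j\<in>(UNIV::'n set). norm x)"
      using norm_vec_le_sum[of "mrep x"] by linarith
    then show "norm (mrep x) \<le> norm x * (real CARD('n) * real CARD('n))"
      by (simp add: mult_ac)
  qed
qed

lemma bounded_linear_mabs:
  "bounded_linear (mabs :: 'a::{euclidean_space,real_normed_field}^'n::finite^'n \<Rightarrow> ('a,'n) sq_matrix)"
proof
  show "mabs (M + N) = mabs M + mabs N" "mabs (r *\<^sub>R M) = r *\<^sub>R mabs M" for r and M N :: "'a^'n^'n"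
    by (simp_all add: plus_sq_matrix.abs_eq scaleR_sq_matrix.abs_eq)
  show "\<exists>K. \<forall>M::'a^'n^'n. norm (mabs M) \<le> norm M * K"
  proof (intro exI allI)
    fix M :: "'a^'n^'n"
    have "norm (M $ i $ j) \<le> norm M" for i j
      using Finite_Cartesian_Product.norm_nth_le[of "M $ i" j] Finite_Cartesian_Product.norm_nth_le[of M i]
      by linarith
    then have "norm (mabs M) \<le> (\<Sum>i\<in>(UNIV::'n set). \<Sum>j\<in>(UNIV::'n set). norm M)"
      unfolding norm_sq_matrix.abs_eq
      by (intro order_trans[OF onorm_le_matrix_entries] sum_mono)
    then show "norm (mabs M) \<le> norm M * (real CARD('n) * real CARD('n))"
      by (simp add: mult_ac)
  qed
qed

instance sq_matrix :: ("{euclidean_space,real_normed_field}", finite) banach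
proof
  fix X :: "nat \<Rightarrow> ('a,'b) sq_matrix"
  assume "Cauchy X"
  then have "Cauchy (\<lambda>k. mrep (X k))"
    by (rule bounded_linear.Cauchy[OF bounded_linear_mrep])
  then obtain L where "(\<lambda>k. mrep (X k)) \<longlonglongrightarrow> L"
    using Cauchy_convergent_iff convergent_def by blast
  then have "(\<lambda>k. mabs (mrep (X k))) \<longlonglongrightarrow> mabs L"
    by (rule bounded_linear.tendsto[OF bounded_linear_mabs])
  then show "convergent X"
    by (auto simp: mrep_inverse intro: convergentI)
qed

section \<open>The matrix exponential\<close>

lemma sums_matpow_exp:
  fixes M :: "'a::{euclidean_space,real_normed_field}^'n::finite^'n"
  shows "(\<lambda>k. (t ^ k / fact k) *\<^sub>R matpow M k) sums mrep (exp (t *\<^sub>R mabs M))"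
proof -
  have "(\<lambda>k. mrep ((t *\<^sub>R mabs M) ^ k /\<^sub>R fact k)) sums mrep (exp (t *\<^sub>R mabs M))"
    by (rule bounded_linear.sums[OF bounded_linear_mrep exp_converges])
  then show ?thesis
    by (simp add: mrep_scaleR mrep_power mabs_inverse divide_inverse_commute)
qed

lemma mexp_conv_exp:
  fixes M :: "'a::{euclidean_space,real_normed_field}^'n::finite^'n"
  shows "mexp M t = mrep (exp (t *\<^sub>R mabs M))"
  unfolding mexp_def by (rule sums_unique[OF sums_matpow_exp, symmetric])

lemma sums_mexp:
  fixes M :: "'a::{euclidean_space,real_normed_field}^'n::finite^'n"
  shows "(\<lambda>k. (t ^ k / fact k) *\<^sub>R matpow M k) sums mexp M t"
  unfolding mexp_conv_exp by (rule sums_matpow_exp)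

lemma mexp_transfer:
  fixes M :: "'a::{euclidean_space,real_normed_field}^'n::finite^'n"
    and N :: "'b::{euclidean_space,real_normed_field}^'m::finite^'m"
  assumes f: "bounded_linear f" and pow: "\<And>k. f (matpow M k) = matpow N k"
  shows "f (mexp M t) = mexp N t"
proof -
  have "(\<lambda>k. f ((t ^ k / fact k) *\<^sub>R matpow M k)) sums f (mexp M t)"
    by (rule bounded_linear.sums[OF f sums_mexp])
  then have "(\<lambda>k. (t ^ k / fact k) *\<^sub>R matpow N k) sums f (mexp M t)"
    by (simp add: pow linear_scale[OF bounded_linear.linear[OF f]])
  then show ?thesis
    using sums_mexp sums_unique2 by blast
qed

lemma has_vector_derivative_mexp:
  fixes M :: "'a::{euclidean_space,real_normed_field}^'n::finite^'n"
  shows "(mexp M has_vector_derivative (M ** mexp M t)) (at t within U)"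
proof -
  have "((\<lambda>t. mrep (exp (t *\<^sub>R mabs M))) has_vector_derivative mrep (mabs M * exp (t *\<^sub>R mabs M)))
      (at t within U)"
    by (rule bounded_linear.has_vector_derivative[OF bounded_linear_mrep
          has_vector_derivative_at_within[OF exp_scaleR_has_vector_derivative_left]])
  then show ?thesis
    by (simp add: mexp_conv_exp[abs_def] mrep_mult mabs_inverse mexp_conv_exp)
qed

lemma mexp_commute:
  fixes M :: "'a::{euclidean_space,real_normed_field}^'n::finite^'n"
  shows "M ** mexp M t = mexp M t ** M"
proof -
  have "mrep (mabs M * exp (t *\<^sub>R mabs M)) = mrep (exp (t *\<^sub>R mabs M) * mabs M)"
    by (simp add: exp_times_scaleR_commute)
  then show ?thesis
    by (simp add: mexp_conv_exp mrep_mult mabs_inverse)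
qed

lemma has_vector_derivative_mexp_right:
  fixes M :: "'a::{euclidean_space,real_normed_field}^'n::finite^'n"
  shows "(mexp M has_vector_derivative (mexp M t ** M)) (at t within U)"
  using has_vector_derivative_mexp[of M t U] by (simp add: mexp_commute)

lemma mexp_zero [simp]:
  fixes M :: "'a::{euclidean_space,real_normed_field}^'n::finite^'n"
  shows "mexp M 0 = mat 1"
  by (simp add: mexp_conv_exp mrep_one)

lemma mexp_scaleR:
  fixes M :: "'a::{euclidean_space,real_normed_field}^'n::finite^'n"
  shows "mexp (c *\<^sub>R M) t = mexp M (t * c)"
  by (simp add: mexp_conv_exp scaleR_sq_matrix.abs_eq[symmetric] mabs_inverse)

lemma mexp_add_commuting:
  fixes M N :: "'a::{euclidean_space,real_normed_field}^'n::finite^'n"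
  assumes "M ** N = N ** M"
  shows "mexp (M + N) t = mexp M t ** mexp N t"
proof -
  have "(t *\<^sub>R mabs M) * (t *\<^sub>R mabs N) = (t *\<^sub>R mabs N) * (t *\<^sub>R mabs M)"
    using assms by (simp add: times_sq_matrix.abs_eq)
  then have "exp (t *\<^sub>R mabs M + t *\<^sub>R mabs N) = exp (t *\<^sub>R mabs M) * exp (t *\<^sub>R mabs N)"
    by (rule exp_add_commuting)
  then show ?thesis
    by (simp add: mexp_conv_exp mrep_mult plus_sq_matrix.abs_eq[symmetric] scaleR_add_right)
qed

lemma mexp_add_scaleR_commuting:
  fixes M E :: "'a::{euclidean_space,real_normed_field}^'n::finite^'n"
  assumes "M ** E = E ** M"
  shows "mexp (M + t *\<^sub>R E) s = mexp (s *\<^sub>R E) t ** mexp M s"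
proof -
  have "(t *\<^sub>R E) ** M = M ** (t *\<^sub>R E)"
    using assms by (simp add: scaleR_matrix_matrix_mult_right[symmetric] scalar_matrix_assoc[symmetric])
  then have "mexp (t *\<^sub>R E + M) s = mexp (t *\<^sub>R E) s ** mexp M s"
    by (rule mexp_add_commuting)
  then show ?thesis
    by (simp add: add.commute mexp_scaleR mult.commute)
qed

lemma continuous_on_mexp [continuous_intros]:
  fixes M :: "'a::{euclidean_space,real_normed_field}^'n::finite^'n"
  shows "continuous_on S f \<Longrightarrow> continuous_on S (\<lambda>s. mexp M (f s))"
  by (rule continuous_on_compose2[of UNIV "mexp M"])
    (auto intro: has_vector_derivative_continuous has_vector_derivative_mexp continuous_at_imp_continuous_on)

lemma matpow_commute: "matpow M k ** M = M ** matpow M k"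
  by (induct k) (simp_all, metis matrix_mul_assoc)

lemma matpow_transpose: "transpose (matpow (M::'a::comm_semiring_1^'n::finite^'n) k) = matpow (transpose M) k"
  by (induct k) (simp_all add: matrix_transpose_mul matpow_commute)

lemma matpow_similar:
  fixes M S Sinv :: "'a::semiring_1^'n::finite^'n"
  assumes "S ** Sinv = mat 1" and "Sinv ** S = mat 1"
  shows "matpow (Sinv ** M ** S) k = Sinv ** matpow M k ** S"
proof (induct k)
  case 0
  then show ?case
    using assms by (simp add: matrix_mul_assoc)
next
  case (Suc k)
  have "Sinv ** M ** S ** (Sinv ** matpow M k ** S) = Sinv ** M ** (S ** Sinv) ** matpow M k ** S"
    by (simp add: matrix_mul_assoc)
  then show ?case
    using Suc assms by (simp add: matrix_mul_assoc)
qed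

section \<open>Matrix-valued functions\<close>

lemma bounded_bilinear_matrix_mult:
  "bounded_bilinear ((**) :: 'a::{euclidean_space,real_normed_field}^'n::finite^'m::finite \<Rightarrow> 'a^'p::finite^'n \<Rightarrow> _)"
proof -
  have "bilinear ((**) :: 'a^'n^'m \<Rightarrow> 'a^'p^'n \<Rightarrow> _)"
    unfolding bilinear_def linear_iff
    by (auto simp: matrix_add_ldistrib matrix_add_rdistrib matrix_scalar_ac scalar_matrix_assoc)
  then show ?thesis
    using bilinear_conv_bounded_bilinear by blast
qed

lemmas continuous_on_matrix_mult [continuous_intros] =
  bounded_bilinear.continuous_on[OF bounded_bilinear_matrix_mult]

lemmas has_vector_derivative_matrix_mult =
  bounded_bilinear.has_vector_derivative[OF bounded_bilinear_matrix_mult]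

lemma bounded_linear_matrix_mult_left:
  "bounded_linear (\<lambda>X. (X::'a::{euclidean_space,real_normed_field}^'n::finite^'m::finite) ** (K :: 'a^'p::finite^'n))"
  by (rule bounded_bilinear.bounded_linear_left[OF bounded_bilinear_matrix_mult])

lemma bounded_linear_matrix_mult_right:
  "bounded_linear (\<lambda>X. (K::'a::{euclidean_space,real_normed_field}^'n::finite^'m::finite) ** (X :: 'a^'p::finite^'n))"
  by (rule bounded_bilinear.bounded_linear_right[OF bounded_bilinear_matrix_mult])

lemma integrable_matrix_mult_left:
  fixes f :: "real \<Rightarrow> 'a::{euclidean_space,real_normed_field}^'n::finite^'m::finite" and K :: "'a^'p::finite^'n"
  shows "f integrable_on S \<Longrightarrow> (\<lambda>s. f s ** K) integrable_on S"
  using integrable_linear[OF _ bounded_linear_matrix_mult_left] by (simp add: o_def)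

lemma integrable_matrix_mult_right:
  fixes f :: "real \<Rightarrow> 'a::{euclidean_space,real_normed_field}^'p::finite^'n::finite" and K :: "'a^'n^'m::finite"
  shows "f integrable_on S \<Longrightarrow> (\<lambda>s. K ** f s) integrable_on S"
  using integrable_linear[OF _ bounded_linear_matrix_mult_right] by (simp add: o_def)

lemma integral_matrix_mult_left:
  fixes f :: "real \<Rightarrow> 'a::{euclidean_space,real_normed_field}^'n::finite^'m::finite" and K :: "'a^'p::finite^'n"
  shows "f integrable_on S \<Longrightarrow> integral S (\<lambda>s. f s ** K) = integral S f ** K"
  using integral_linear[OF _ bounded_linear_matrix_mult_left] by (simp add: o_def)

lemma integral_matrix_mult_right:
  fixes f :: "real \<Rightarrow> 'a::{euclidean_space,real_normed_field}^'p::finite^'n::finite" and K :: "'a^'n^'m::finite"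
  shows "f integrable_on S \<Longrightarrow> integral S (\<lambda>s. K ** f s) = K ** integral S f"
  using integral_linear[OF _ bounded_linear_matrix_mult_right] by (simp add: o_def)

lemma bounded_linear_transpose:
  "bounded_linear (transpose :: 'a::{euclidean_space,real_normed_field}^'n::finite^'m::finite \<Rightarrow> _)"
  unfolding linear_conv_bounded_linear[symmetric] linear_iff
  by (simp add: transpose_def vec_eq_iff)

lemma mexp_transpose:
  fixes M :: "'a::{euclidean_space,real_normed_field}^'n::finite^'n"
  shows "transpose (mexp M t) = mexp (transpose M) t"
  by (rule mexp_transfer[OF bounded_linear_transpose matpow_transpose])

lemma mexp_similar:
  fixes M S Sinv :: "'a::{euclidean_space,real_normed_field}^'n::finite^'n"
  assumes "S ** Sinv = mat 1" and "Sinv ** S = mat 1"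
  shows "mexp (Sinv ** M ** S) t = Sinv ** mexp M t ** S"
proof (rule mexp_transfer[symmetric])
  show "bounded_linear (\<lambda>X. Sinv ** X ** S)"
    by (rule bounded_linear_compose[OF bounded_linear_matrix_mult_left bounded_linear_matrix_mult_right])
  show "Sinv ** matpow M k ** S = matpow (Sinv ** M ** S) k" for k
    by (rule matpow_similar[OF assms, symmetric])
qed

lemma cmat_mult: "cmat (A ** B) = cmat A ** cmat B"
  by (simp add: cmat_def matrix_matrix_mult_def vec_eq_iff)

lemma cmat_diff: "cmat (A - B) = cmat A - cmat B"
  and cmat_scaleR: "cmat (r *\<^sub>R A) = r *\<^sub>R cmat A"
  and cmat_transpose: "cmat (transpose A) = transpose (cmat A)"
  and cmat_mat: "cmat (mat 1) = mat 1"
  and cmat_zero: "cmat 0 = 0"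
  by (simp_all add: cmat_def transpose_def mat_def vec_eq_iff scaleR_conv_of_real[where 'a=complex])

lemma bounded_linear_cmat: "bounded_linear (cmat :: real^'c::finite^'r::finite \<Rightarrow> _)"
  unfolding linear_conv_bounded_linear[symmetric] linear_iff
  by (simp add: cmat_def vec_eq_iff scaleR_conv_of_real[where 'a=complex])

lemma cmat_mexp: "cmat (mexp A t) = mexp (cmat A) t"
proof (rule mexp_transfer[OF bounded_linear_cmat])
  show "cmat (matpow A k) = matpow (cmat A) k" for k
    by (induct k) (simp_all add: cmat_mat cmat_mult)
qed

lemma integral_cmat:
  fixes f :: "real \<Rightarrow> real^'c::finite^'r::finite"
  shows "f integrable_on S \<Longrightarrow> integral S (\<lambda>s. cmat (f s)) = cmat (integral S f)"
  using integral_linear[OF _ bounded_linear_cmat] by (simp add: o_def)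

lemma continuous_on_transpose [continuous_intros]:
  "continuous_on S f \<Longrightarrow>
    continuous_on S (\<lambda>x. transpose (f x :: 'a::{euclidean_space,real_normed_field}^'n::finite^'m::finite))"
  by (rule bounded_linear.continuous_on[OF bounded_linear_transpose])

section \<open>Sylvester equations and time-limited Gramians\<close>

definition tl_gramian ::
  "'a::{euclidean_space,real_normed_field}^'n::finite^'n \<Rightarrow> 'a^'m::finite^'n \<Rightarrow> 'a^'m^'m \<Rightarrow> real \<Rightarrow> 'a^'m^'n"
  where "tl_gramian K1 X K2 T = integral {0..T} (\<lambda>s. mexp K1 s ** X ** mexp K2 s)"

definition weighted_tl_gramian ::
  "'a::{euclidean_space,real_normed_field}^'n::finite^'n \<Rightarrow> 'a^'m::finite^'n \<Rightarrow> 'a^'m^'m \<Rightarrow> real \<Rightarrow> 'a^'m^'n"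
  where "weighted_tl_gramian K1 X K2 T = integral {0..T} (\<lambda>s. s *\<^sub>R (mexp K1 s ** X ** mexp K2 s))"

lemma integrable_mexp_sandwich:
  fixes K1 :: "'a::{euclidean_space,real_normed_field}^'n::finite^'n" and K2 :: "'a^'m::finite^'m"
  shows "(\<lambda>s. mexp K1 s ** X ** mexp K2 s) integrable_on {a..b}"
    and "(\<lambda>s. s *\<^sub>R (mexp K1 s ** X ** mexp K2 s)) integrable_on {a..b}"
  by (intro integrable_continuous_interval continuous_intros)+

lemma has_vector_derivative_mexp_sandwich:
  fixes K1 :: "'a::{euclidean_space,real_normed_field}^'n::finite^'n" and K2 :: "'a^'m::finite^'m"
  shows "((\<lambda>s. mexp K1 s ** X ** mexp K2 s) has_vector_derivative
      (K1 ** (mexp K1 s ** X ** mexp K2 s) + (mexp K1 s ** X ** mexp K2 s) ** K2)) (at s within U)"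
proof -
  have "((\<lambda>s. mexp K1 s ** X) has_vector_derivative (mexp K1 s ** 0 + (K1 ** mexp K1 s) ** X)) (at s within U)"
    by (rule has_vector_derivative_matrix_mult[OF has_vector_derivative_mexp has_vector_derivative_const])
  from has_vector_derivative_matrix_mult[OF this has_vector_derivative_mexp_right]
  show ?thesis
    by (simp add: matrix_mul_assoc add.commute)
qed

lemma integral_sylvester_fundamental:
  fixes F H :: "real \<Rightarrow> 'a::{euclidean_space,real_normed_field}^'m::finite^'n::finite"
    and K1 :: "'a^'n^'n" and K2 :: "'a^'m^'m"
  assumes "0 \<le> T" and F: "\<And>s. (F has_vector_derivative (K1 ** F s + F s ** K2 + H s)) (at s)"
    and "continuous_on {0..T} F" "continuous_on {0..T} H"
  shows "K1 ** integral {0..T} F + integral {0..T} F ** K2 + integral {0..T} H = F T - F 0"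
proof -
  have iF: "F integrable_on {0..T}" and iH: "H integrable_on {0..T}"
    by (rule integrable_continuous_interval, fact)+
  have i1: "(\<lambda>s. K1 ** F s) integrable_on {0..T}" and i2: "(\<lambda>s. F s ** K2) integrable_on {0..T}"
    by (rule integrable_matrix_mult_right[OF iF], rule integrable_matrix_mult_left[OF iF])
  have "((\<lambda>s. K1 ** F s + F s ** K2 + H s) has_integral (F T - F 0)) {0..T}"
    by (rule fundamental_theorem_of_calculus[OF \<open>0 \<le> T\<close>]) (rule has_vector_derivative_at_within[OF F])
  then have "integral {0..T} (\<lambda>s. K1 ** F s + F s ** K2 + H s) = F T - F 0"
    by (rule integral_unique)
  then show ?thesis
    by (simp only: integral_add[OF integrable_add[OF i1 i2] iH] integral_add[OF i1 i2]
        integral_matrix_mult_right[OF iF] integral_matrix_mult_left[OF iF])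
qed

lemma sylvester_tl_gramian:
  fixes K1 :: "'a::{euclidean_space,real_normed_field}^'n::finite^'n" and K2 :: "'a^'m::finite^'m"
  assumes "0 \<le> T"
  shows "K1 ** tl_gramian K1 X K2 T + tl_gramian K1 X K2 T ** K2 = mexp K1 T ** X ** mexp K2 T - X"
proof -
  have "((\<lambda>s. mexp K1 s ** X ** mexp K2 s) has_vector_derivative
      (K1 ** (mexp K1 s ** X ** mexp K2 s) + (mexp K1 s ** X ** mexp K2 s) ** K2 + 0)) (at s)" for s
    using has_vector_derivative_mexp_sandwich by simp
  from integral_sylvester_fundamental[OF assms this]
  show ?thesis
    by (simp add: tl_gramian_def continuous_intros)
qed

text \<open>Apply the fundamental theorem to \<open>s F s\<close>, whose derivative has the extra term \<open>F s\<close>.\<close>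

lemma sylvester_weighted_tl_gramian:
  fixes K1 :: "'a::{euclidean_space,real_normed_field}^'n::finite^'n" and K2 :: "'a^'m::finite^'m"
  assumes "0 \<le> T"
  shows "K1 ** weighted_tl_gramian K1 X K2 T + weighted_tl_gramian K1 X K2 T ** K2
    = T *\<^sub>R (mexp K1 T ** X ** mexp K2 T) - tl_gramian K1 X K2 T"
proof -
  define F where "F = (\<lambda>s. mexp K1 s ** X ** mexp K2 s)"
  have "(F has_vector_derivative (K1 ** F s + F s ** K2)) (at s)" for s
    unfolding F_def by (rule has_vector_derivative_mexp_sandwich)
  note dsF = has_vector_derivative_scaleR[OF DERIV_ident this]
  have "s *\<^sub>R (K1 ** F s + F s ** K2) + 1 *\<^sub>R F s = K1 ** (s *\<^sub>R F s) + (s *\<^sub>R F s) ** K2 + F s" for s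
    by (simp only: scaleR_add_right scaleR_one)
      (subst scaleR_matrix_matrix_mult_right, subst scalar_matrix_assoc, rule refl)
  then have "((\<lambda>s. s *\<^sub>R F s) has_vector_derivative (K1 ** (s *\<^sub>R F s) + (s *\<^sub>R F s) ** K2 + F s)) (at s)" for s
    using dsF[of s] by (simp only:)
  from integral_sylvester_fundamental[OF assms this]
  have "K1 ** integral {0..T} (\<lambda>s. s *\<^sub>R F s) + integral {0..T} (\<lambda>s. s *\<^sub>R F s) ** K2 + integral {0..T} F
      = T *\<^sub>R F T"
    unfolding F_def by (simp add: continuous_intros)
  then show ?thesis
    by (simp add: weighted_tl_gramian_def tl_gramian_def F_def algebra_simps)
qed

lemma tl_gramian_unique:
  fixes K1 :: "'a::{euclidean_space,real_normed_field}^'n::finite^'n" and K2 :: "'a^'m::finite^'m"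
  assumes "0 \<le> T" and hom: "\<And>Y. K1 ** Y + Y ** K2 = 0 \<Longrightarrow> Y = 0"
    and P: "K1 ** P + P ** K2 = - X + mexp K1 T ** X ** mexp K2 T"
  shows "P = tl_gramian K1 X K2 T"
proof -
  have "K1 ** P + P ** K2 = K1 ** tl_gramian K1 X K2 T + tl_gramian K1 X K2 T ** K2"
    by (simp add: P sylvester_tl_gramian[OF \<open>0 \<le> T\<close>])
  then have "K1 ** (P - tl_gramian K1 X K2 T) + (P - tl_gramian K1 X K2 T) ** K2 = 0"
    by (simp add: matrix_diff_ldistrib matrix_diff_rdistrib algebra_simps)
  then have "P - tl_gramian K1 X K2 T = 0"
    by (rule hom)
  then show ?thesis
    by simp
qed

definition diagonal_matrix :: "'a::zero^'n^'n \<Rightarrow> bool"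
  where "diagonal_matrix D \<longleftrightarrow> (\<forall>i j. i \<noteq> j \<longrightarrow> D $ i $ j = 0)"

lemma sum_UNIV_single:
  fixes g :: "'n::finite \<Rightarrow> 'a::comm_monoid_add"
  assumes "\<And>k. k \<noteq> b \<Longrightarrow> g k = 0"
  shows "(\<Sum>k\<in>UNIV. g k) = g b"
  using sum.remove[of UNIV b g] assms by (simp add: sum.neutral)

lemma diagonal_matrix_mult_right:
  assumes "diagonal_matrix D"
  shows "(Y ** D) $ a $ b = Y $ a $ b * (D $ b $ b :: 'a::semiring_1)"
proof -
  have "(Y ** D) $ a $ b = (\<Sum>k\<in>UNIV. Y $ a $ k * D $ k $ b)"
    by (simp add: matrix_matrix_mult_def)
  also have "\<dots> = Y $ a $ b * D $ b $ b"
    using assms by (intro sum_UNIV_single) (simp add: diagonal_matrix_def)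
  finally show ?thesis .
qed

lemma diagonal_matrix_mult_left:
  assumes "diagonal_matrix D"
  shows "(D ** Y) $ a $ b = (D $ a $ a :: 'a::semiring_1) * Y $ a $ b"
proof -
  have "(D ** Y) $ a $ b = (\<Sum>k\<in>UNIV. D $ a $ k * Y $ k $ b)"
    by (simp add: matrix_matrix_mult_def)
  also have "\<dots> = D $ a $ a * Y $ a $ b"
    using assms by (intro sum_UNIV_single) (simp add: diagonal_matrix_def)
  finally show ?thesis .
qed

lemma diagonal_matrix_vector_mult:
  assumes "diagonal_matrix D"
  shows "(D *v v) $ i = (D $ i $ i :: 'a::semiring_1) * v $ i"
proof -
  have "(D *v v) $ i = (\<Sum>j\<in>UNIV. D $ i $ j * v $ j)"
    by (simp add: matrix_vector_mult_def)
  also have "\<dots> = D $ i $ i * v $ i"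
    using assms by (intro sum_UNIV_single) (simp add: diagonal_matrix_def)
  finally show ?thesis .
qed

lemma diagonal_matrix_transpose: "diagonal_matrix D \<Longrightarrow> transpose D = D"
  unfolding diagonal_matrix_def transpose_def by (simp add: vec_eq_iff) metis

lemma mat_matrix_vector_mult: "mat c *v x = c *s (x::'a::semiring_1^'n::finite)"
  unfolding matrix_vector_mult_def mat_def vec_eq_iff by (auto intro: trans[OF sum_UNIV_single])

lemma ceigenvalue_iff_not_invertible: "ceigenvalue K l \<longleftrightarrow> \<not> invertible (K - mat l)"
proof -
  have "(K - mat l) *v x = 0 \<longleftrightarrow> K *v x = l *s x" for x
    by (simp add: matrix_vector_mult_diff_rdistrib mat_matrix_vector_mult)
  then show ?thesis
    unfolding ceigenvalue_def invertible_left_inverse matrix_left_invertible_ker by auto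
qed

lemma invertible_transpose: "invertible (transpose (M :: 'a::comm_semiring_1^'n::finite^'n)) \<longleftrightarrow> invertible M"
  unfolding invertible_def by (metis matrix_transpose_mul transpose_mat transpose_transpose)

lemma ceigenvalue_transpose: "ceigenvalue (transpose (K :: complex^'n::finite^'n)) l \<longleftrightarrow> ceigenvalue K l"
proof -
  have "transpose K - mat l = transpose (K - mat l)"
    by (simp add: transpose_def mat_def vec_eq_iff)
  then show ?thesis
    by (simp add: ceigenvalue_iff_not_invertible invertible_transpose)
qed

lemma ceigenvalue_diagonal:
  assumes "diagonal_matrix D" and "ceigenvalue D l"
  shows "\<exists>i. l = D $ i $ i"
proof -
  obtain v where "v \<noteq> 0" and v: "D *v v = l *s v"
    using assms(2) unfolding ceigenvalue_def by blast
  then obtain i where "v $ i \<noteq> 0"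
    by (auto simp: vec_eq_iff)
  moreover have "D $ i $ i * v $ i = l * v $ i"
    using arg_cong[OF v, of "\<lambda>w. w $ i"] by (simp add: diagonal_matrix_vector_mult[OF assms(1)])
  ultimately show ?thesis
    by auto
qed

lemma sylvester_homogeneous_diagonal_right:
  fixes K :: "complex^'n::finite^'n" and D :: "complex^'r::finite^'r" and Y :: "complex^'r^'n"
  assumes D: "diagonal_matrix D" and ev: "\<And>j. \<not> ceigenvalue K (- D $ j $ j)"
    and eq: "K ** Y + Y ** D = 0"
  shows "Y = 0"
proof -
  have "column j Y = 0" for j
  proof -
    have "(K ** Y) $ a $ j = - D $ j $ j * Y $ a $ j" for a
      using arg_cong[OF eq, of "\<lambda>M. M $ a $ j"]
      by (simp add: diagonal_matrix_mult_right[OF D] eq_neg_iff_add_eq_0 mult.commute)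
    moreover have "(K *v column j Y) $ a = (K ** Y) $ a $ j" for a
      by (simp add: matrix_vector_mult_def matrix_matrix_mult_def column_def)
    ultimately have "K *v column j Y = (- D $ j $ j) *s column j Y"
      by (simp add: vec_eq_iff column_def)
    then show ?thesis
      using ev unfolding ceigenvalue_def by blast
  qed
  then show ?thesis
    by (simp add: vec_eq_iff column_def)
qed

lemma sylvester_homogeneous_diagonal_left:
  fixes K :: "complex^'n::finite^'n" and D :: "complex^'r::finite^'r" and Y :: "complex^'n^'r"
  assumes D: "diagonal_matrix D" and ev: "\<And>j. \<not> ceigenvalue K (- D $ j $ j)"
    and eq: "D ** Y + Y ** K = 0"
  shows "Y = 0"
proof -
  have "transpose K ** transpose Y + transpose Y ** D = transpose (D ** Y + Y ** K)"
    by (simp add: transpose_add matrix_transpose_mul diagonal_matrix_transpose[OF D] add.commute)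
  also have "\<dots> = 0"
    by (simp add: eq transpose_def vec_eq_iff)
  finally have "transpose K ** transpose Y + transpose Y ** D = 0" .
  moreover have "\<not> ceigenvalue (transpose K) (- D $ j $ j)" for j
    by (simp add: ceigenvalue_transpose ev)
  ultimately have "transpose Y = 0"
    using sylvester_homogeneous_diagonal_right[OF D] by blast
  then show ?thesis
    by (simp add: transpose_def vec_eq_iff)
qed

lemma sylvester_homogeneous_diagonal:
  fixes D Y :: "complex^'r::finite^'r"
  assumes D: "diagonal_matrix D" and DmD: "\<And>i j. D $ i $ i + D $ j $ j \<noteq> 0"
    and eq: "D ** Y + Y ** D = 0"
  shows "Y = 0"
proof (rule sylvester_homogeneous_diagonal_right[OF D _ eq])
  show "\<not> ceigenvalue D (- D $ j $ j)" for j
  proof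
    assume "ceigenvalue D (- D $ j $ j)"
    then obtain i where "- D $ j $ j = D $ i $ i"
      using ceigenvalue_diagonal[OF D] by blast
    then show False
      using DmD[of i j] by (metis add.commute neg_eq_iff_add_eq_0)
  qed
qed

lemma diagonal_entry_sylvester_swap:
  fixes D :: "'a::comm_ring_1^'r::finite^'r" and K :: "'a^'n::finite^'n" and Q :: "'a^'n^'r" and R :: "'a^'r^'n"
  assumes D: "diagonal_matrix D" and Q: "D ** Q + Q ** K = - W" and R: "K ** R + R ** D = - X"
  shows "(Q ** X) $ i $ i = (W ** R) $ i $ i"
proof -
  have "X = - (K ** R + R ** D)"
    using R by simp
  then have "(Q ** X) $ i $ i = - (Q ** K ** R) $ i $ i - ((Q ** R) ** D) $ i $ i"
    by (simp add: matrix_diff_ldistrib matrix_neg_ldistrib matrix_mul_assoc)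
  also have "\<dots> = - (Q ** K ** R) $ i $ i - (D ** (Q ** R)) $ i $ i"
    by (simp add: diagonal_matrix_mult_right[OF D] diagonal_matrix_mult_left[OF D] mult.commute)
  also have "\<dots> = - ((D ** Q + Q ** K) ** R) $ i $ i"
    by (simp add: matrix_add_rdistrib matrix_mul_assoc)
  finally show ?thesis
    by (simp add: Q matrix_neg_rdistrib)
qed

section \<open>First-order optimality conditions\<close>

lemma integral_inner_eq_0_of_local_min:
  fixes F F' :: "real \<Rightarrow> real \<Rightarrow> 'v::euclidean_space"
  assumes D: "\<And>t s. ((\<lambda>t. F t s) has_vector_derivative F' t s) (at t)"
    and cF: "continuous_on UNIV (\<lambda>(t,s). F t s)" and cF': "continuous_on UNIV (\<lambda>(t,s). F' t s)"
    and "d > 0"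
    and min: "\<And>t. \<bar>t\<bar> < d \<Longrightarrow> integral {0..T} (\<lambda>s. (norm (F 0 s))\<^sup>2) \<le> integral {0..T} (\<lambda>s. (norm (F t s))\<^sup>2)"
  shows "integral {0..T} (\<lambda>s. inner (F 0 s) (F' 0 s)) = 0"
proof -
  have cFt: "continuous_on UNIV (F t)" for t
  proof -
    have "continuous_on UNIV ((\<lambda>(t,s). F t s) \<circ> Pair t)"
      by (rule continuous_on_compose) (auto intro!: continuous_intros continuous_on_subset[OF cF])
    then show ?thesis
      by (simp add: o_def)
  qed
  have dF: "((\<lambda>t. (norm (F t s))\<^sup>2) has_field_derivative 2 * inner (F t s) (F' t s)) (at t within UNIV)" for t s
  proof -
    have "((\<lambda>t. inner (F t s) (F t s)) has_vector_derivative (inner (F t s) (F' t s) + inner (F' t s) (F t s))) (at t)"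
      by (rule bounded_bilinear.has_vector_derivative[OF bounded_bilinear_inner D D])
    then show ?thesis
      unfolding has_real_derivative_iff_has_vector_derivative power2_norm_eq_inner
      by (simp add: inner_commute[of "F' t s"])
  qed
  have int: "(\<lambda>s. (norm (F t s))\<^sup>2) integrable_on cbox 0 T" for t
    by (rule integrable_continuous) (intro continuous_intros continuous_on_subset[OF cFt], simp)
  have cdF: "continuous_on (UNIV \<times> cbox 0 T) (\<lambda>(t, s). 2 * inner (F t s) (F' t s))"
  proof -
    have "(\<lambda>(t, s). 2 * inner (F t s) (F' t s)) = (\<lambda>p. 2 * inner ((\<lambda>(t,s). F t s) p) ((\<lambda>(t,s). F' t s) p))"
      by auto
    then show ?thesis
      by (simp only:) (intro continuous_intros continuous_on_subset[OF cF] continuous_on_subset[OF cF'], auto)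
  qed
  have "((\<lambda>t. integral (cbox 0 T) (\<lambda>s. (norm (F t s))\<^sup>2)) has_field_derivative
      integral (cbox 0 T) (\<lambda>s. 2 * inner (F 0 s) (F' 0 s))) (at 0 within UNIV)"
    by (rule leibniz_rule_field_derivative[OF dF int cdF]) auto
  then have "integral (cbox 0 T) (\<lambda>s. 2 * inner (F 0 s) (F' 0 s)) = 0"
    by (rule DERIV_local_min[OF _ \<open>d > 0\<close>]) (use min in \<open>auto simp: cbox_interval\<close>)
  then show ?thesis
    by (simp add: cbox_interval)
qed

definition frob_inner :: "'a::comm_ring_1^'c::finite^'r::finite \<Rightarrow> 'a^'c^'r \<Rightarrow> 'a"
  where "frob_inner X Y = (\<Sum>k\<in>UNIV. \<Sum>l\<in>UNIV. X $ k $ l * Y $ k $ l)"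

lemma sum_swap3:
  "(\<Sum>k\<in>A. \<Sum>l\<in>B. \<Sum>n\<in>C. f k l n) = (\<Sum>n\<in>C. \<Sum>l\<in>B. \<Sum>k\<in>A. f k l n)"
proof -
  have "(\<Sum>k\<in>A. \<Sum>l\<in>B. \<Sum>n\<in>C. f k l n) = (\<Sum>k\<in>A. \<Sum>n\<in>C. \<Sum>l\<in>B. f k l n)"
    by (rule sum.cong[OF refl], rule sum.swap)
  also have "\<dots> = (\<Sum>n\<in>C. \<Sum>k\<in>A. \<Sum>l\<in>B. f k l n)"
    by (rule sum.swap)
  also have "\<dots> = (\<Sum>n\<in>C. \<Sum>l\<in>B. \<Sum>k\<in>A. f k l n)"
    by (rule sum.cong[OF refl], rule sum.swap)
  finally show ?thesis .
qed

lemma frob_inner_mult_left: "frob_inner (A ** B) C = frob_inner B (transpose A ** C)"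
  unfolding frob_inner_def matrix_matrix_mult_def transpose_def
  by (simp add: sum_distrib_left sum_distrib_right mult_ac) (rule sum_swap3)

lemma frob_inner_mult_right: "frob_inner (A ** B) C = frob_inner A (C ** transpose B)"
  unfolding frob_inner_def matrix_matrix_mult_def transpose_def
  by (simp add: sum_distrib_left sum_distrib_right mult_ac) (rule sum.cong, simp, subst sum.swap, simp)

lemma inner_matrix_eq_frob_inner: "inner (X::real^'c::finite^'r::finite) Y = frob_inner X Y"
  by (simp add: inner_vec_def frob_inner_def)

lemma inner_matrix_mult_left: "inner X (A ** B) = inner (transpose A ** X) (B::real^'c::finite^'n::finite)"
proof -
  have "inner X (A ** B) = frob_inner (A ** B) X"
    by (simp add: inner_matrix_eq_frob_inner[symmetric] inner_commute)
  also have "\<dots> = inner B (transpose A ** X)"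
    by (simp add: inner_matrix_eq_frob_inner frob_inner_mult_left)
  finally show ?thesis
    by (simp add: inner_commute)
qed

lemma inner_matrix_mult_right: "inner X (A ** B) = inner (X ** transpose B) (A::real^'n::finite^'r::finite)"
proof -
  have "inner X (A ** B) = frob_inner (A ** B) X"
    by (simp add: inner_matrix_eq_frob_inner[symmetric] inner_commute)
  also have "\<dots> = inner A (X ** transpose B)"
    by (simp add: inner_matrix_eq_frob_inner frob_inner_mult_right)
  finally show ?thesis
    by (simp add: inner_commute)
qed

lemma integral_inner_const:
  fixes f :: "real \<Rightarrow> 'v::euclidean_space"
  shows "f integrable_on S \<Longrightarrow> integral S (\<lambda>s. inner (f s) E) = inner (integral S f) E"
  using integral_linear[OF _ bounded_linear_inner_left] by (simp add: o_def)

definition tlh2_residual ::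
  "real^'n^'n \<Rightarrow> real^'m^'n \<Rightarrow> real^'n^'p \<Rightarrow> real^'r^'r \<Rightarrow> real^'m^'r \<Rightarrow> real^'r^'p \<Rightarrow> real \<Rightarrow> real^'m^'p"
  where "tlh2_residual A B C Ah Bh Ch s = C ** mexp A s ** B - Ch ** mexp Ah s ** Bh"

lemma continuous_on_tlh2_residual [continuous_intros]:
  "continuous_on S f \<Longrightarrow> continuous_on S (\<lambda>x. tlh2_residual A B C Ah Bh Ch (f x))"
  unfolding tlh2_residual_def by (intro continuous_intros)

lemma tlh2_locally_optimal_along_line:
  assumes "tlh2_locally_optimal A B C T Ah Bh Ch"
  obtains d where "d > 0" and "\<And>t. \<bar>t\<bar> < d \<Longrightarrow>
    tlh2_err A B C T Ah Bh Ch \<le> tlh2_err A B C T (Ah + t *\<^sub>R EA) (Bh + t *\<^sub>R EB) (Ch + t *\<^sub>R EC)"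
proof -
  obtain \<epsilon> where "\<epsilon> > 0" and min: "\<And>Ah' Bh' Ch'. norm (Ah' - Ah) + norm (Bh' - Bh) + norm (Ch' - Ch) < \<epsilon> \<Longrightarrow>
      tlh2_err A B C T Ah Bh Ch \<le> tlh2_err A B C T Ah' Bh' Ch'"
    using assms unfolding tlh2_locally_optimal_def by blast
  define N where "N = norm EA + norm EB + norm EC + 1"
  have "N > 0"
    unfolding N_def by (simp add: add_nonneg_pos)
  show ?thesis
  proof (rule that)
    show "\<epsilon> / N > 0"
      using \<open>\<epsilon> > 0\<close> \<open>N > 0\<close> by simp
    fix t :: real
    assume "\<bar>t\<bar> < \<epsilon> / N"
    then have "\<bar>t\<bar> * N < \<epsilon>"
      using \<open>N > 0\<close> by (simp add: pos_less_divide_eq)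
    moreover have "\<bar>t\<bar> * (norm EA + norm EB + norm EC) \<le> \<bar>t\<bar> * N"
      unfolding N_def by (simp add: mult_left_mono)
    ultimately show "tlh2_err A B C T Ah Bh Ch \<le> tlh2_err A B C T (Ah + t *\<^sub>R EA) (Bh + t *\<^sub>R EB) (Ch + t *\<^sub>R EC)"
      by (intro min) (simp add: distrib_left)
  qed
qed

lemma tlh2_stationary_direction:
  fixes G G' :: "real \<Rightarrow> real \<Rightarrow> real^'m^'p"
  assumes opt: "tlh2_locally_optimal A B C T Ah Bh Ch"
    and D: "\<And>t s. ((\<lambda>t. G t s) has_vector_derivative G' t s) (at t)"
    and cG: "continuous_on UNIV (\<lambda>(t,s). G t s)" and cG': "continuous_on UNIV (\<lambda>(t,s). G' t s)"
    and G0: "\<And>s. G 0 s = 0"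
    and line: "\<And>t s. tlh2_residual A B C (Ah + t *\<^sub>R EA) (Bh + t *\<^sub>R EB) (Ch + t *\<^sub>R EC) s
      = tlh2_residual A B C Ah Bh Ch s - G t s"
  shows "integral {0..T} (\<lambda>s. inner (tlh2_residual A B C Ah Bh Ch s) (G' 0 s)) = 0"
proof -
  let ?Z = "tlh2_residual A B C Ah Bh Ch"
  obtain d where "d > 0" and min: "\<And>t. \<bar>t\<bar> < d \<Longrightarrow>
      tlh2_err A B C T Ah Bh Ch \<le> tlh2_err A B C T (Ah + t *\<^sub>R EA) (Bh + t *\<^sub>R EB) (Ch + t *\<^sub>R EC)"
    using tlh2_locally_optimal_along_line[OF opt] by blast
  have cZ: "continuous_on UNIV (\<lambda>(t::real, s). ?Z s)"
    by (simp add: split_beta continuous_intros)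
  have "integral {0..T} (\<lambda>s. inner ((\<lambda>t s. ?Z s - G t s) 0 s) ((\<lambda>t s. - G' t s) 0 s)) = 0"
  proof (intro integral_inner_eq_0_of_local_min[OF _ _ _ \<open>d > 0\<close>])
    show "((\<lambda>t. ?Z s - G t s) has_vector_derivative - G' t s) (at t)" for t s
      using has_vector_derivative_diff[OF has_vector_derivative_const D] by simp
    show "continuous_on UNIV (\<lambda>(t, s). ?Z s - G t s)"
      using continuous_on_diff[OF cZ cG] by (simp add: split_beta)
    show "continuous_on UNIV (\<lambda>(t, s). - G' t s)"
      using continuous_on_minus[OF cG'] by (simp add: split_beta)
    show "integral {0..T} (\<lambda>s. (norm (?Z s - G 0 s))\<^sup>2) \<le> integral {0..T} (\<lambda>s. (norm (?Z s - G t s))\<^sup>2)"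
      if "\<bar>t\<bar> < d" for t
      using min[OF that] by (simp add: tlh2_err_def tlh2_residual_def[symmetric] line G0)
  qed
  then show ?thesis
    by (simp add: G0 integral_neg)
qed

lemma has_vector_derivative_scaleR_const: "((\<lambda>t. t *\<^sub>R X) has_vector_derivative X) (at t)"
  using has_vector_derivative_scaleR[OF DERIV_ident has_vector_derivative_const[of X]] by simp

lemma tlh2_stationary_Ch:
  assumes opt: "tlh2_locally_optimal A B C T Ah Bh Ch"
  shows "integral {0..T} (\<lambda>s. tlh2_residual A B C Ah Bh Ch s ** transpose (mexp Ah s ** Bh)) = 0"
proof -
  let ?Z = "tlh2_residual A B C Ah Bh Ch" and ?W = "\<lambda>s. mexp Ah s ** Bh"
  define M where "M = integral {0..T} (\<lambda>s. ?Z s ** transpose (?W s))"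
  have "integral {0..T} (\<lambda>s. inner (?Z s) (M ** ?W s)) = 0"
  proof (rule tlh2_stationary_direction[OF opt, where EA = 0 and EB = 0 and EC = M])
    show "tlh2_residual A B C (Ah + t *\<^sub>R 0) (Bh + t *\<^sub>R 0) (Ch + t *\<^sub>R M) s = ?Z s - t *\<^sub>R (M ** ?W s)" for t s
      by (simp add: tlh2_residual_def matrix_add_rdistrib scalar_matrix_assoc matrix_mul_assoc)
  qed (auto simp: split_beta has_vector_derivative_scaleR_const intro!: continuous_intros)
  moreover have "(\<lambda>s. ?Z s ** transpose (?W s)) integrable_on {0..T}"
    by (intro integrable_continuous_interval continuous_intros)
  ultimately have "inner M M = 0"
    by (simp add: inner_matrix_mult_right integral_inner_const M_def)
  then show ?thesis
    by (simp add: M_def)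
qed

lemma tlh2_stationary_Bh:
  assumes opt: "tlh2_locally_optimal A B C T Ah Bh Ch"
  shows "integral {0..T} (\<lambda>s. transpose (Ch ** mexp Ah s) ** tlh2_residual A B C Ah Bh Ch s) = 0"
proof -
  let ?Z = "tlh2_residual A B C Ah Bh Ch" and ?V = "\<lambda>s. Ch ** mexp Ah s"
  define M where "M = integral {0..T} (\<lambda>s. transpose (?V s) ** ?Z s)"
  have "integral {0..T} (\<lambda>s. inner (?Z s) (?V s ** M)) = 0"
  proof (rule tlh2_stationary_direction[OF opt, where EA = 0 and EB = M and EC = 0])
    show "tlh2_residual A B C (Ah + t *\<^sub>R 0) (Bh + t *\<^sub>R M) (Ch + t *\<^sub>R 0) s = ?Z s - t *\<^sub>R (?V s ** M)" for t s
      by (simp add: tlh2_residual_def matrix_add_ldistrib scaleR_matrix_matrix_mult_right)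
  qed (auto simp: split_beta has_vector_derivative_scaleR_const intro!: continuous_intros)
  moreover have "(\<lambda>s. transpose (?V s) ** ?Z s) integrable_on {0..T}"
    by (intro integrable_continuous_interval continuous_intros)
  ultimately have "inner M M = 0"
    by (simp add: inner_matrix_mult_left integral_inner_const M_def)
  then show ?thesis
    by (simp add: M_def)
qed

text \<open>Only perturbations \<open>Ah + t E\<close> with \<open>E\<close> commuting with \<open>Ah\<close> are used: for them the
  exponential factorizes as in \<open>mexp_add_scaleR_commuting\<close>, which makes the \<open>t\<close>-derivative explicit.\<close>

lemma tlh2_stationary_Ah:
  assumes opt: "tlh2_locally_optimal A B C T Ah Bh Ch" and comm: "Ah ** E = E ** Ah"
  shows "inner (integral {0..T} (\<lambda>s. s *\<^sub>R
    (transpose Ch ** (tlh2_residual A B C Ah Bh Ch s ** transpose (mexp Ah s ** Bh))))) E = 0"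
proof -
  let ?Z = "tlh2_residual A B C Ah Bh Ch" and ?W = "\<lambda>s. mexp Ah s ** Bh"
  have zero: "integral {0..T} (\<lambda>s. inner (?Z s) (Ch ** ((s *\<^sub>R E) ** mexp (s *\<^sub>R E) 0) ** ?W s)) = 0"
  proof (rule tlh2_stationary_direction[OF opt, where EA = E and EB = 0 and EC = 0
        and G = "\<lambda>t s. Ch ** (mexp (s *\<^sub>R E) t - mat 1) ** ?W s"])
    show "((\<lambda>t. Ch ** (mexp (s *\<^sub>R E) t - mat 1) ** ?W s) has_vector_derivative
        Ch ** ((s *\<^sub>R E) ** mexp (s *\<^sub>R E) t) ** ?W s) (at t)" for t s
    proof -
      have "((\<lambda>t. mexp (s *\<^sub>R E) t - mat 1) has_vector_derivative (s *\<^sub>R E) ** mexp (s *\<^sub>R E) t) (at t)"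
        using has_vector_derivative_diff[OF has_vector_derivative_mexp has_vector_derivative_const] by simp
      from has_vector_derivative_matrix_mult[OF has_vector_derivative_matrix_mult[OF
            has_vector_derivative_const this] has_vector_derivative_const]
      show ?thesis
        by simp
    qed
    show "tlh2_residual A B C (Ah + t *\<^sub>R E) (Bh + t *\<^sub>R 0) (Ch + t *\<^sub>R 0) s
      = ?Z s - Ch ** (mexp (s *\<^sub>R E) t - mat 1) ** ?W s" for t s
      using mexp_add_scaleR_commuting[OF comm, of t s]
      by (simp add: tlh2_residual_def matrix_diff_rdistrib matrix_diff_ldistrib matrix_mul_assoc)
  qed (auto simp: split_beta mexp_scaleR intro!: continuous_intros)
  have eq: "inner (?Z s) (Ch ** ((s *\<^sub>R E) ** mexp (s *\<^sub>R E) 0) ** ?W s)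
      = inner (s *\<^sub>R (transpose Ch ** (?Z s ** transpose (?W s)))) E" for s
  proof -
    have "inner (?Z s) (Ch ** ((s *\<^sub>R E) ** mexp (s *\<^sub>R E) 0) ** ?W s) = inner (?Z s) (Ch ** (s *\<^sub>R E) ** ?W s)"
      by simp
    also have "\<dots> = inner (transpose Ch ** (?Z s ** transpose (?W s))) (s *\<^sub>R E)"
      by (simp only: inner_matrix_mult_right[of "?Z s" "Ch ** (s *\<^sub>R E)"]
          inner_matrix_mult_left[of "?Z s ** transpose (?W s)" Ch])
    also have "\<dots> = inner (s *\<^sub>R (transpose Ch ** (?Z s ** transpose (?W s)))) E"
      by simp
    finally show ?thesis .
  qed
  have int: "(\<lambda>s. s *\<^sub>R (transpose Ch ** (?Z s ** transpose (?W s)))) integrable_on {0..T}"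
    by (intro integrable_continuous_interval continuous_intros)
  from zero have "integral {0..T} (\<lambda>s. inner (s *\<^sub>R (transpose Ch ** (?Z s ** transpose (?W s)))) E) = 0"
    by (simp only: eq)
  then show ?thesis
    by (simp only: integral_inner_const[OF int])
qed

section \<open>Passing to the diagonalizing basis\<close>

lemma frob_inner_axis: "frob_inner (axis k (axis l 1)) X = X $ k $ l"
proof -
  have "frob_inner (axis k (axis l 1)) X = (\<Sum>a\<in>UNIV. if a = k then X $ k $ l else 0)"
    unfolding frob_inner_def
  proof (rule sum.cong[OF refl])
    fix a
    show "(\<Sum>b\<in>UNIV. axis k (axis l 1) $ a $ b * X $ a $ b) = (if a = k then X $ k $ l else 0)"
      by (cases "a = k") (auto simp: axis_def intro: trans[OF sum_UNIV_single[where b = l]])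
  qed
  then show ?thesis
    by simp
qed

text \<open>The real and imaginary parts of \<open>Sinv e\<^sub>i e\<^sub>i\<^sup>T S\<close> commute with \<open>Ah\<close>; testing
  \<open>G\<close> against them extracts the \<open>i\<close>-th diagonal entry of \<open>H\<close>.\<close>

lemma diagonal_entry_eq_0_of_orthogonal_commutant:
  fixes Ah G :: "real^'r::finite^'r" and S Sinv D H :: "complex^'r^'r"
  assumes S_inv1: "S ** Sinv = mat 1" and S_inv2: "Sinv ** S = mat 1"
    and D: "diagonal_matrix D" and Ah_diag: "cmat Ah = Sinv ** D ** S"
    and orth: "\<And>E. Ah ** E = E ** Ah \<Longrightarrow> inner G E = 0"
    and G: "cmat G = transpose S ** H ** transpose Sinv"
  shows "H $ i $ i = 0"
proof -
  define U :: "complex^'r^'r" where "U = axis i (axis i 1)"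
  define P where "P = Sinv ** U ** S"
  have "D ** U = U ** D"
    by (simp add: vec_eq_iff diagonal_matrix_mult_left[OF D] diagonal_matrix_mult_right[OF D] U_def axis_def)
  then have "cmat Ah ** P = P ** cmat Ah"
    unfolding Ah_diag P_def
    by (metis (no_types, lifting) S_inv1 matrix_mul_assoc matrix_mul_lid)
  then have "(cmat Ah ** P) $ a $ b = (P ** cmat Ah) $ a $ b" for a b
    by simp
  then have "Ah ** (\<chi> a b. Re (P $ a $ b)) = (\<chi> a b. Re (P $ a $ b)) ** Ah"
    and "Ah ** (\<chi> a b. Im (P $ a $ b)) = (\<chi> a b. Im (P $ a $ b)) ** Ah"
    by (simp_all add: vec_eq_iff matrix_matrix_mult_def cmat_def Re_sum Im_sum mult.commute complex_eq_iff)
  then have "inner G (\<chi> a b. Re (P $ a $ b)) = 0" "inner G (\<chi> a b. Im (P $ a $ b)) = 0"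
    by (simp_all add: orth)
  then have "frob_inner P (cmat G) = 0"
    by (simp add: inner_matrix_eq_frob_inner frob_inner_def cmat_def complex_eq_iff Re_sum Im_sum mult.commute)
  moreover have "frob_inner P (cmat G) = frob_inner U (transpose Sinv ** transpose S ** H ** (transpose Sinv ** transpose S))"
    unfolding P_def G by (subst frob_inner_mult_right, subst frob_inner_mult_left) (simp add: matrix_mul_assoc)
  moreover have "transpose Sinv ** transpose S = mat 1"
    using S_inv1 by (metis matrix_transpose_mul transpose_mat)
  ultimately show ?thesis
    by (simp add: U_def frob_inner_axis)
qed

locale tlh2_diagonalized =
  fixes A :: "real^'n::finite^'n" and B :: "real^'m::finite^'n" and C :: "real^'n^'p::finite"
    and Ah :: "real^'r::finite^'r" and Bh :: "real^'m^'r" and Ch :: "real^'r^'p" and T :: real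
    and S Sinv D :: "complex^'r^'r" and Bt :: "complex^'m^'r" and Ct :: "complex^'r^'p"
  assumes opt: "tlh2_locally_optimal A B C T Ah Bh Ch"
    and S_inv1: "S ** Sinv = mat 1" and S_inv2: "Sinv ** S = mat 1"
    and diag: "diagonal_matrix D" and Ah_diag: "cmat Ah = Sinv ** D ** S"
    and Bt_def: "Bt = S ** cmat Bh" and Ct_def: "Ct = cmat Ch ** Sinv"
begin

text \<open>The paper's \<open>P\<^sub>T\<close>, \<open>P\<^sub>2\<^sub>,\<^sub>T\<close>, \<open>Q\<^sub>T\<close>, \<open>Q\<^sub>2\<^sub>,\<^sub>T\<close> (in the eigenbasis of \<open>Ah\<close>),
  and the \<open>s\<close>-weighted integrals producing the \<open>T e\<^bsup>\<dots>\<^esup>\<close> terms of condition (3).\<close>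

abbreviation "gramian_P \<equiv> tl_gramian D (Bt ** transpose Bt) D T"
abbreviation "gramian_P2 \<equiv> tl_gramian (cmat A) (cmat B ** transpose Bt) D T"
abbreviation "gramian_Q \<equiv> tl_gramian D (transpose Ct ** Ct) D T"
abbreviation "gramian_Q2 \<equiv> tl_gramian D (transpose Ct ** cmat C) (cmat A) T"
abbreviation "weighted_P \<equiv> weighted_tl_gramian D (Bt ** transpose Bt) D T"
abbreviation "weighted_P2 \<equiv> weighted_tl_gramian (cmat A) (cmat B ** transpose Bt) D T"

lemma transpose_Sinv_S: "transpose Sinv ** transpose S = mat 1"
  using S_inv1 by (metis matrix_transpose_mul transpose_mat)

lemma cmat_Ch: "cmat Ch = Ct ** S"
  by (simp add: Ct_def matrix_mul_assoc[symmetric] S_inv2)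

lemma transpose_mexp_D: "transpose (mexp D s) = mexp D s"
  by (simp add: mexp_transpose diagonal_matrix_transpose[OF diag])

lemma cmat_mexp_Ah: "cmat (mexp Ah s) = Sinv ** mexp D s ** S"
  by (simp add: cmat_mexp Ah_diag mexp_similar[OF S_inv1 S_inv2])

lemma cmat_mexp_Ah_Bh: "cmat (mexp Ah s ** Bh) = Sinv ** mexp D s ** Bt"
  by (simp add: cmat_mult cmat_mexp_Ah Bt_def matrix_mul_assoc)

lemma cmat_Ch_mexp_Ah: "cmat (Ch ** mexp Ah s) = Ct ** mexp D s ** S"
proof -
  have "cmat (Ch ** mexp Ah s) = Ct ** (S ** Sinv) ** mexp D s ** S"
    by (simp add: cmat_mult cmat_mexp_Ah cmat_Ch matrix_mul_assoc)
  then show ?thesis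
    by (simp add: S_inv1)
qed

lemma cmat_tlh2_residual:
  "cmat (tlh2_residual A B C Ah Bh Ch s) = cmat C ** mexp (cmat A) s ** cmat B - Ct ** mexp D s ** Bt"
proof -
  have "cmat (Ch ** mexp Ah s ** Bh) = Ct ** mexp D s ** Bt"
    using cmat_Ch_mexp_Ah[of s] by (simp add: cmat_mult Bt_def matrix_mul_assoc)
  then show ?thesis
    by (simp add: tlh2_residual_def cmat_diff cmat_mult cmat_mexp)
qed

lemma cmat_residual_times_output:
  "cmat (tlh2_residual A B C Ah Bh Ch s ** transpose (mexp Ah s ** Bh))
    = (cmat C ** (mexp (cmat A) s ** (cmat B ** transpose Bt) ** mexp D s)
       - Ct ** (mexp D s ** (Bt ** transpose Bt) ** mexp D s)) ** transpose Sinv"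
proof -
  have "cmat (tlh2_residual A B C Ah Bh Ch s ** transpose (mexp Ah s ** Bh))
      = cmat (tlh2_residual A B C Ah Bh Ch s) ** transpose (Sinv ** mexp D s ** Bt)"
    by (simp only: cmat_mult[of "tlh2_residual A B C Ah Bh Ch s"] cmat_transpose cmat_mexp_Ah_Bh)
  then show ?thesis
    by (simp add: cmat_tlh2_residual matrix_transpose_mul transpose_mexp_D matrix_diff_rdistrib matrix_mul_assoc)
qed

lemma cmat_input_times_residual:
  "cmat (transpose (Ch ** mexp Ah s) ** tlh2_residual A B C Ah Bh Ch s)
    = transpose S ** ((mexp D s ** (transpose Ct ** cmat C) ** mexp (cmat A) s) ** cmat B
       - (mexp D s ** (transpose Ct ** Ct) ** mexp D s) ** Bt)"
proof -
  have "cmat (transpose (Ch ** mexp Ah s) ** tlh2_residual A B C Ah Bh Ch s)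
      = transpose (Ct ** mexp D s ** S) ** cmat (tlh2_residual A B C Ah Bh Ch s)"
    by (simp only: cmat_mult[of "transpose (Ch ** mexp Ah s)"] cmat_transpose cmat_Ch_mexp_Ah)
  then show ?thesis
    by (simp add: cmat_tlh2_residual matrix_transpose_mul transpose_mexp_D matrix_diff_ldistrib matrix_mul_assoc)
qed

lemma Ct_gramian_P: "Ct ** gramian_P = cmat C ** gramian_P2"
proof -
  have "(\<lambda>s. tlh2_residual A B C Ah Bh Ch s ** transpose (mexp Ah s ** Bh)) integrable_on {0..T}"
    by (intro integrable_continuous_interval continuous_intros)
  then have "0 = integral {0..T} (\<lambda>s. cmat (tlh2_residual A B C Ah Bh Ch s ** transpose (mexp Ah s ** Bh)))"
    using tlh2_stationary_Ch[OF opt] by (simp add: integral_cmat cmat_zero)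
  also have "\<dots> = (cmat C ** gramian_P2 - Ct ** gramian_P) ** transpose Sinv"
    by (simp add: cmat_residual_times_output tl_gramian_def integrable_mexp_sandwich integral_diff
        integrable_diff integral_matrix_mult_left integral_matrix_mult_right integrable_matrix_mult_right)
  finally have "(cmat C ** gramian_P2 - Ct ** gramian_P) ** (transpose Sinv ** transpose S) = 0"
    by (simp add: matrix_mul_assoc)
  then show ?thesis
    by (simp add: transpose_Sinv_S)
qed

lemma gramian_Q_Bt: "gramian_Q ** Bt = gramian_Q2 ** cmat B"
proof -
  have "(\<lambda>s. transpose (Ch ** mexp Ah s) ** tlh2_residual A B C Ah Bh Ch s) integrable_on {0..T}"
    by (intro integrable_continuous_interval continuous_intros)
  then have "0 = integral {0..T} (\<lambda>s. cmat (transpose (Ch ** mexp Ah s) ** tlh2_residual A B C Ah Bh Ch s))"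
    using tlh2_stationary_Bh[OF opt] by (simp add: integral_cmat cmat_zero)
  also have "\<dots> = transpose S ** (gramian_Q2 ** cmat B - gramian_Q ** Bt)"
    by (simp add: cmat_input_times_residual tl_gramian_def integrable_mexp_sandwich integral_diff
        integrable_diff integral_matrix_mult_left integral_matrix_mult_right integrable_matrix_mult_left)
  finally have "transpose Sinv ** (transpose S ** (gramian_Q2 ** cmat B - gramian_Q ** Bt)) = 0"
    by simp
  then show ?thesis
    by (simp add: matrix_mul_assoc transpose_Sinv_S)
qed

lemma weighted_gramians_diagonal:
  "(transpose Ct ** cmat C ** weighted_P2) $ i $ i = (transpose Ct ** Ct ** weighted_P) $ i $ i"
proof -
  let ?Z = "tlh2_residual A B C Ah Bh Ch" and ?W = "\<lambda>s. mexp Ah s ** Bh"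
  define H where "H = transpose Ct ** cmat C ** weighted_P2 - transpose Ct ** Ct ** weighted_P"
  have "cmat (s *\<^sub>R (transpose Ch ** (?Z s ** transpose (?W s))))
      = transpose S ** (transpose Ct ** cmat C ** (s *\<^sub>R (mexp (cmat A) s ** (cmat B ** transpose Bt) ** mexp D s))
         - transpose Ct ** Ct ** (s *\<^sub>R (mexp D s ** (Bt ** transpose Bt) ** mexp D s))) ** transpose Sinv" for s
  proof -
    have "cmat (s *\<^sub>R (transpose Ch ** (?Z s ** transpose (?W s))))
        = s *\<^sub>R (transpose (Ct ** S) ** cmat (?Z s ** transpose (?W s)))"
      by (simp only: cmat_scaleR cmat_mult[of "transpose Ch"] cmat_transpose cmat_Ch)
    then show ?thesis
      unfolding cmat_residual_times_output
      by (simp add: matrix_transpose_mul matrix_diff_ldistrib matrix_diff_rdistrib matrix_mul_assoc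
          scaleR_matrix_matrix_mult_right[symmetric] scalar_matrix_assoc[symmetric] scaleR_diff_right)
  qed
  moreover have "(\<lambda>s. s *\<^sub>R (transpose Ch ** (?Z s ** transpose (?W s)))) integrable_on {0..T}"
    by (intro integrable_continuous_interval continuous_intros)
  ultimately have "cmat (integral {0..T} (\<lambda>s. s *\<^sub>R (transpose Ch ** (?Z s ** transpose (?W s)))))
      = transpose S ** H ** transpose Sinv"
    by (simp add: integral_cmat[symmetric] H_def weighted_tl_gramian_def integrable_mexp_sandwich integral_diff
        integrable_diff integral_matrix_mult_left integral_matrix_mult_right integrable_matrix_mult_left
        integrable_matrix_mult_right)
  then have "H $ i $ i = 0"
    using tlh2_stationary_Ah[OF opt]
    by (intro diagonal_entry_eq_0_of_orthogonal_commutant[OF S_inv1 S_inv2 diag Ah_diag]) auto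
  then show ?thesis
    by (simp add: H_def)
qed

lemma Qinf_weighted_gramians_diagonal:
  assumes Qinf: "D ** Qinf + Qinf ** D = - (transpose Ct ** Ct)"
    and Q2inf: "D ** Q2inf + Q2inf ** cmat A = - (transpose Ct ** cmat C)"
  shows "(Q2inf ** - (cmat A ** weighted_P2 + weighted_P2 ** D)) $ i $ i
    = (Qinf ** - (D ** weighted_P + weighted_P ** D)) $ i $ i"
proof -
  have "(Q2inf ** - (cmat A ** weighted_P2 + weighted_P2 ** D)) $ i $ i
      = (transpose Ct ** cmat C ** weighted_P2) $ i $ i"
    by (rule diagonal_entry_sylvester_swap[OF diag Q2inf]) simp
  also have "\<dots> = (transpose Ct ** Ct ** weighted_P) $ i $ i"
    by (rule weighted_gramians_diagonal)
  also have "\<dots> = (Qinf ** - (D ** weighted_P + weighted_P ** D)) $ i $ i"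
    by (rule diagonal_entry_sylvester_swap[OF diag Qinf, symmetric]) simp
  finally show ?thesis .
qed

end

theorem theorem3p2:
  fixes A :: "real^'n^'n" and B :: "real^'m^'n" and C :: "real^'n^'p"
    and Ah :: "real^'r^'r" and Bh :: "real^'m^'r" and Ch :: "real^'r^'p"
    and T :: real
    and S Sinv D :: "complex^'r^'r"
    and Bt :: "complex^'m^'r" and Ct :: "complex^'r^'p"
    and PT QT Qinf :: "complex^'r^'r"
    and P2T :: "complex^'r^'n" and Q2T Q2inf :: "complex^'n^'r"
  assumes hurw: "hurwitz A"
    and Tpos: "T > 0"
    and opt: "tlh2_locally_optimal A B C T Ah Bh Ch"
    and S_inv1: "S ** Sinv = mat 1" and S_inv2: "Sinv ** S = mat 1"
    and diag: "\<forall>i j. i \<noteq> j \<longrightarrow> D $ i $ j = 0"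
    and Ah_diag: "cmat Ah = Sinv ** D ** S"
    and DmD: "\<forall>i j. D $ i $ i + D $ j $ j \<noteq> 0"
    and DmA: "\<forall>i. \<not> ceigenvalue (cmat A) (- (D $ i $ i))"
    and Bt_def: "Bt = S ** cmat Bh"
    and Ct_def: "Ct = cmat Ch ** Sinv"
    and P2T_eq: "cmat A ** P2T + P2T ** D =
        - (cmat B ** transpose Bt) + mexp (cmat A) T ** cmat B ** transpose Bt ** mexp D T"
    and PT_eq: "D ** PT + PT ** D =
        - (Bt ** transpose Bt) + mexp D T ** Bt ** transpose Bt ** mexp D T"
    and Q2T_eq: "D ** Q2T + Q2T ** cmat A =
        - (transpose Ct ** cmat C) + mexp D T ** transpose Ct ** cmat C ** mexp (cmat A) T"
    and QT_eq: "D ** QT + QT ** D =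
        - (transpose Ct ** Ct) + mexp D T ** transpose Ct ** Ct ** mexp D T"
    and Qinf_eq: "D ** Qinf + Qinf ** D = - (transpose Ct ** Ct)"
    and Q2inf_eq: "D ** Q2inf + Q2inf ** cmat A = - (transpose Ct ** cmat C)"
  shows "Ct ** PT = cmat C ** P2T \<and> QT ** Bt = Q2T ** cmat B \<and>
         (\<forall>i. (Q2inf ** (P2T - T *\<^sub>R (mexp (cmat A) T ** cmat B ** transpose Bt ** mexp D T))) $ i $ i
           = (Qinf ** (PT - T *\<^sub>R (mexp D T ** Bt ** transpose Bt ** mexp D T))) $ i $ i)"
proof -
  have D: "diagonal_matrix D"
    using diag by (simp add: diagonal_matrix_def)
  interpret tlh2_diagonalized A B C Ah Bh Ch T S Sinv D Bt Ct
    using opt S_inv1 S_inv2 D Ah_diag Bt_def Ct_def by unfold_locales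
  have T: "0 \<le> T"
    using Tpos by simp
  have P: "PT = gramian_P" and Q: "QT = gramian_Q"
    by (rule tl_gramian_unique[OF T sylvester_homogeneous_diagonal[OF D]],
        use DmD PT_eq QT_eq in \<open>simp_all add: matrix_mul_assoc\<close>)+
  have P2: "P2T = gramian_P2"
    by (rule tl_gramian_unique[OF T sylvester_homogeneous_diagonal_right[OF D]])
      (use DmA P2T_eq in \<open>simp_all add: matrix_mul_assoc\<close>)
  have Q2: "Q2T = gramian_Q2"
    by (rule tl_gramian_unique[OF T sylvester_homogeneous_diagonal_left[OF D]])
      (use DmA Q2T_eq in \<open>simp_all add: matrix_mul_assoc\<close>)
  have "P2T - T *\<^sub>R (mexp (cmat A) T ** cmat B ** transpose Bt ** mexp D T)
      = - (cmat A ** weighted_P2 + weighted_P2 ** D)"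
    and "PT - T *\<^sub>R (mexp D T ** Bt ** transpose Bt ** mexp D T) = - (D ** weighted_P + weighted_P ** D)"
    by (simp_all add: P P2 sylvester_weighted_tl_gramian[OF T] matrix_mul_assoc)
  then show ?thesis
    using Ct_gramian_P gramian_Q_Bt Qinf_weighted_gramians_diagonal[OF Qinf_eq Q2inf_eq] by (simp add: P P2 Q Q2)
qed

end
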